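(* Let $n\ge 4$ be divisible by $4$, and let $D\subseteq\{d : d\mid n,\ 1\le d<n\}$ be a set of divisors of $n$ with $n/2\notin D$ and $n/4\notin D$. Then $\mathrm{ICG}_n(D\cup\{n/4\})$ has perfect state transfer if and only if $\mathrm{ICG}_n(D\cup\{n/2\})$ has perfect state transfer.
   Context: For $E\subseteq\{d : d\mid n,\ 1\le d<n\}$, $\mathrm{ICG}_n(E)$ is the graph on $\mathbb{Z}_n=\{0,\dots,n-1\}$ where $a,b$ are adjacent iff $\gcd(a-b,n)\in E$. With $A$ its adjacency matrix and $F(t)=\exp(\mathrm{i}At)$, the graph has perfect state transfer if there exist distinct vertices $a,b$ and $\tau>0$ with $|F(\tau)_{ab}|=1$. *)

theory Defs
  imports
    Complex_Main
    "Graph_Theory.Pair_Digraph"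
    "Jordan_Normal_Form.Matrix"
begin

text \<open>
  As usual in the graph library used here, an undirected simple graph is a symmetric
  loop-free digraph without parallel arcs, see the locale \<open>pair_graph\<close>.
\<close>

definition ICG :: "nat \<Rightarrow> nat set \<Rightarrow> nat pair_pre_digraph" where
  "ICG n E = \<lparr> pverts = {0..<n},
     parcs = {(a, b). a < n \<and> b < n \<and> nat (gcd (int a - int b) (int n)) \<in> E} \<rparr>"

lemma pair_graph_ICG:
  assumes "E \<subseteq> {d. d dvd n \<and> 1 \<le> d \<and> d < n}"
  shows "pair_graph (ICG n E)"
proof -
  have fin: "finite {(a, b). a < n \<and> b < n \<and> nat (gcd (int a - int b) (int n)) \<in> E}"
    by (rule finite_subset[of _ "{..<n} \<times> {..<n}"]) auto
  have sym: "gcd (int b - int a) (int n) = gcd (int a - int b) (int n)" for a b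
    by (metis gcd_neg1_int minus_diff_eq)
  show ?thesis
    by unfold_locales
      (use assms fin in \<open>auto simp: ICG_def symmetric_def sym intro!: symI\<close>)
qed

text \<open>
  Rows and columns are indexed from \<open>0\<close>, so the following two definitions are meant for
  graphs whose vertex set is an initial segment of the natural numbers, such as \<open>ICG n E\<close>.
\<close>

definition adjacency_matrix :: "nat pair_pre_digraph \<Rightarrow> complex mat" where
  "adjacency_matrix G = mat (card (pverts G)) (card (pverts G))
     (\<lambda>(a, b). if (a, b) \<in> parcs G then 1 else 0)"

definition mat_exp :: "complex mat \<Rightarrow> complex mat" where
  "mat_exp A = mat (dim_row A) (dim_row A) (\<lambda>(i, j). \<Sum>k. (A ^\<^sub>m k) $$ (i, j) / fact k)"

text \<open>The exponential series of a square matrix converges in every entry.\<close>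

lemma summable_mat_exp:
  fixes A :: "complex mat"
  assumes A: "A \<in> carrier_mat n n" and ij: "i < n" "j < n"
  shows "summable (\<lambda>k. (A ^\<^sub>m k) $$ (i, j) / fact k)"
proof -
  define M where "M = (\<Sum>a<n. \<Sum>b<n. cmod (A $$ (a, b)))"
  have entry: "cmod (A $$ (a, b)) \<le> M" if "a < n" "b < n" for a b
  proof -
    have "cmod (A $$ (a, b)) \<le> (\<Sum>b<n. cmod (A $$ (a, b)))"
      using that by (intro member_le_sum) auto
    also have "\<dots> \<le> M"
      unfolding M_def using that
      by (intro member_le_sum[where f = "\<lambda>a. \<Sum>b<n. cmod (A $$ (a, b))"]) (auto intro: sum_nonneg)
    finally show ?thesis .
  qed
  have bound: "cmod ((A ^\<^sub>m k) $$ (a, b)) \<le> (real n * M) ^ k" if "a < n" "b < n" for a b k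
    using that
  proof (induction k arbitrary: a b)
    case 0
    then show ?case using A by auto
  next
    case (Suc k)
    have P: "A ^\<^sub>m k \<in> carrier_mat n n" using A by simp
    have "(A ^\<^sub>m Suc k) $$ (a, b) = (\<Sum>l = 0..<n. (A ^\<^sub>m k) $$ (a, l) * A $$ (l, b))"
      using A P Suc.prems by (simp add: scalar_prod_def)
    also have "cmod \<dots> \<le> (\<Sum>l = 0..<n. cmod ((A ^\<^sub>m k) $$ (a, l) * A $$ (l, b)))"
      by (rule norm_sum)
    also have "\<dots> \<le> (\<Sum>l = 0..<n. (real n * M) ^ k * M)"
    proof (rule sum_mono)
      fix l assume "l \<in> {0..<n}"
      then have l: "l < n" by simp
      have "0 \<le> (real n * M) ^ k"
        using Suc.IH[OF Suc.prems(1) l] norm_ge_zero order_trans by blast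
      then show "cmod ((A ^\<^sub>m k) $$ (a, l) * A $$ (l, b)) \<le> (real n * M) ^ k * M"
        unfolding norm_mult
        by (intro mult_mono Suc.IH Suc.prems entry l norm_ge_zero)
    qed
    also have "\<dots> = (real n * M) ^ Suc k" by simp
    finally show ?case .
  qed
  show ?thesis
  proof (rule summable_comparison_test)
    show "\<exists>N. \<forall>k\<ge>N. norm ((A ^\<^sub>m k) $$ (i, j) / fact k) \<le> inverse (fact k) * (real n * M) ^ k"
      using bound[OF ij]
      by (intro exI[of _ 0] allI impI)
        (simp add: norm_divide divide_right_mono inverse_eq_divide)
    show "summable (\<lambda>k. inverse (fact k) * (real n * M) ^ k)"
      by (rule summable_exp)
  qed
qed

definition transition_matrix :: "nat pair_pre_digraph \<Rightarrow> real \<Rightarrow> complex mat" where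
  "transition_matrix G t = mat_exp ((\<i> * complex_of_real t) \<cdot>\<^sub>m adjacency_matrix G)"

definition perfect_state_transfer :: "nat pair_pre_digraph \<Rightarrow> bool" where
  "perfect_state_transfer G \<longleftrightarrow>
     (\<exists>a \<in> pverts G. \<exists>b \<in> pverts G. a \<noteq> b \<and>
        (\<exists>\<tau>>0. cmod (transition_matrix G \<tau> $$ (a, b)) = 1))"

end

theory Submission
  imports Defs "HOL-Computational_Algebra.Primes"
begin

text \<open>
  For even \<open>n\<close>, perfect state transfer at time \<open>t\<close> means that \<open>t * (\<lambda>\<^sub>j\<^sub>+\<^sub>1 - \<lambda>\<^sub>j)\<close> is an odd multiple
  of \<open>\<pi>\<close> for all \<open>j\<close>, where the eigenvalues \<open>\<lambda>\<^sub>j\<close> are sums of cosines. The divisors \<open>n / 4\<close> and \<open>n / 2\<close>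
  contribute \<open>2, 0, - 2, 0\<close> and \<open>1, - 1, 1, - 1\<close> (according to \<open>j\<close> modulo 4) to \<open>\<lambda>\<^sub>j\<close>, so the two
  spectra differ by a constant modulo 4. Write \<open>n = 2 ^ k * N\<close> with \<open>N\<close> odd. Summing
  \<open>\<lambda>\<^sub>j\<^sub>+\<^sub>1 - \<lambda>\<^sub>j\<close> over all \<open>j\<close> that are 1 modulo \<open>2 ^ k\<close> cancels the contribution of \<open>D\<close> and leaves
  \<open>- 2 * N\<close> or \<open>2 * N\<close>. Hence \<open>4 * N * t\<close> is a multiple of \<open>2 * \<pi>\<close>, and a transfer time \<open>t\<close> of one graph
  yields the transfer time \<open>N * t\<close> of the other.
\<close>

section \<open>Characters of the integers modulo n and sums over full periods\<close>

text \<open>The additive character of the integers modulo \<open>n\<close>. Integer arguments allow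
  the differences and negations of vertices and indices to be used without truncation.\<close>

definition zeta :: "int \<Rightarrow> int \<Rightarrow> complex" where
  "zeta n x = cis (2 * pi * real_of_int x / real_of_int n)"

lemma zeta_0 [simp]: "zeta n 0 = 1"
  by (simp add: zeta_def)

lemma zeta_add: "zeta n (x + y) = zeta n x * zeta n y"
  by (simp add: zeta_def cis_mult add_divide_distrib algebra_simps)

lemma norm_zeta [simp]: "cmod (zeta n x) = 1"
  by (simp add: zeta_def)

lemma zeta_eq_1_iff:
  assumes "n > 0"
  shows "zeta n x = 1 \<longleftrightarrow> n dvd x"
proof -
  have "zeta n x = 1 \<longleftrightarrow> cos (2 * pi * real_of_int x / real_of_int n) = 1"
    by (auto simp: zeta_def complex_eq_iff sin_cos_squared_add
        intro: cos_one_sin_zero)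
  also have "\<dots> \<longleftrightarrow> (\<exists>k::int. 2 * pi * real_of_int x / real_of_int n = of_int k * 2 * pi)"
    by (simp add: cos_one_2pi_int)
  also have "\<dots> \<longleftrightarrow> (\<exists>k::int. x = n * k)"
  proof (rule ex_cong1)
    fix k
    have "2 * pi * real_of_int x / real_of_int n = of_int k * 2 * pi
        \<longleftrightarrow> real_of_int x = real_of_int (n * k)"
      using assms by (auto simp: field_simps)
    then show "2 * pi * real_of_int x / real_of_int n = of_int k * 2 * pi \<longleftrightarrow> x = n * k"
      by linarith
  qed
  finally show ?thesis by (auto simp: dvd_def)
qed

lemma zeta_mod:
  assumes "n > 0"
  shows "zeta n (x mod n) = zeta n x"
proof -
  have "zeta n x = zeta n (n * (x div n)) * zeta n (x mod n)"
    by (metis zeta_add mult_div_mod_eq)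
  then show ?thesis using assms by (simp add: zeta_eq_1_iff)
qed

lemma zeta_mult_mod:
  assumes "n > 0"
  shows "zeta n (j * (x mod n)) = zeta n (j * x)"
  by (metis assms zeta_mod mod_mult_right_eq)

lemma zeta_cancel:
  assumes "c \<noteq> 0"
  shows "zeta (c * n) (c * x) = zeta n x"
proof -
  have "2 * pi * real_of_int (c * x) / real_of_int (c * n) =
      (real_of_int c * (2 * pi * real_of_int x)) / (real_of_int c * real_of_int n)"
    by (simp add: mult_ac)
  also have "\<dots> = 2 * pi * real_of_int x / real_of_int n"
    using assms by (intro mult_divide_mult_cancel_left) simp
  finally show ?thesis unfolding zeta_def by (rule arg_cong)
qed

lemma gcd_mod_int: "gcd (x mod n) n = gcd x n" for x n :: int
  by (metis gcd.commute gcd_red_int)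

text \<open>Translation permutes the residues modulo \<open>n\<close>, and periodicity hides the
  reduction back into \<open>{0..<n}\<close>.\<close>

lemma sum_periodic_shift:
  fixes f :: "int \<Rightarrow> 'a :: comm_monoid_add"
  assumes "n > 0" "\<And>x. f (x mod n) = f x"
  shows "(\<Sum>x\<in>{0..<n}. f (x + c)) = (\<Sum>x\<in>{0..<n}. f x)"
  using assms(1)
  by (intro sum.reindex_bij_witness[where i = "\<lambda>x. (x - c) mod n" and j = "\<lambda>x. (x + c) mod n"])
    (auto simp: assms(2) mod_simps)

lemma sum_periodic_reflect:
  fixes f :: "int \<Rightarrow> 'a :: comm_monoid_add"
  assumes "n > 0" "\<And>x. f (x mod n) = f x"
  shows "(\<Sum>x\<in>{0..<n}. f (c - x)) = (\<Sum>x\<in>{0..<n}. f x)"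
  using assms(1)
  by (intro sum.reindex_bij_witness[where i = "\<lambda>x. (c - x) mod n" and j = "\<lambda>x. (c - x) mod n"])
    (auto simp: assms(2) mod_simps)

text \<open>Orthogonality of characters: shifting \<open>j\<close> by 1 permutes the residues and
  multiplies the sum by \<open>zeta n x\<close>, which differs from 1 unless \<open>n\<close>
  divides \<open>x\<close>.\<close>

lemma sum_zeta:
  assumes "n > 0"
  shows "(\<Sum>j\<in>{0..<n}. zeta n (j * x)) = (if n dvd x then of_int n else 0)"
proof (cases "n dvd x")
  case True
  then have "zeta n (j * x) = 1" for j
    using assms by (simp add: zeta_eq_1_iff)
  then show ?thesis using True assms by simp
next
  case False
  have "(\<Sum>j\<in>{0..<n}. zeta n (j * x)) = (\<Sum>j\<in>{0..<n}. zeta n ((j + 1) * x))"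
    by (rule sum_periodic_shift[symmetric])
      (use assms zeta_mult_mod[OF assms, of x] in \<open>auto simp: mult.commute\<close>)
  also have "\<dots> = zeta n x * (\<Sum>j\<in>{0..<n}. zeta n (j * x))"
    by (simp add: algebra_simps zeta_add sum_distrib_left)
  finally show ?thesis
    using False assms by (simp add: zeta_eq_1_iff)
qed

section \<open>Eigenvalues as cosine sums\<close>

text \<open>Written with cosines so that the value is real by construction and
  \<open>cis (t * icg_eigenvalue n E j)\<close> is a phase. The index is an integer, so that
  \<open>j + 1\<close> and \<open>- j\<close> need no reduction.\<close>

definition icg_eigenvalue :: "nat \<Rightarrow> nat set \<Rightarrow> int \<Rightarrow> real" where
  "icg_eigenvalue n E j = (\<Sum>a\<in>{0..<int n}.
     if nat (gcd a (int n)) \<in> E then cos (2 * pi * real_of_int (j * a) / real n) else 0)"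

text \<open>Real parts agree term by term. Imaginary parts cancel because \<open>a\<close> and
  \<open>- a\<close> have the same gcd with \<open>n\<close>, while the sine is odd.\<close>

lemma icg_eigenvalue_zeta:
  assumes "n > 0"
  shows "complex_of_real (icg_eigenvalue n E j) =
    (\<Sum>a\<in>{0..<int n}. if nat (gcd a (int n)) \<in> E then zeta (int n) (j * a) else 0)"
    (is "_ = sum ?f _")
proof (rule complex_eqI)
  show "Re (complex_of_real (icg_eigenvalue n E j)) = Re (sum ?f {0..<int n})"
    by (auto simp: icg_eigenvalue_def zeta_def intro!: sum.cong)
  have per: "Im (?f (x mod int n)) = Im (?f x)" for x
    using assms zeta_mult_mod[of "int n" j x] by (simp add: gcd_mod_int)
  have "Im (sum ?f {0..<int n}) = (\<Sum>a\<in>{0..<int n}. Im (?f (0 - a)))"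
    unfolding Im_sum
    by (rule sum_periodic_reflect[symmetric]) (use assms per in auto)
  also have "\<dots> = (\<Sum>a\<in>{0..<int n}. - Im (?f a))"
    by (intro sum.cong) (auto simp: zeta_def)
  finally show "Im (complex_of_real (icg_eigenvalue n E j)) = Im (sum ?f {0..<int n})"
    by (simp add: sum_negf)
qed

lemma icg_eigenvalue_mod:
  assumes "n > 0"
  shows "icg_eigenvalue n E (j mod int n) = icg_eigenvalue n E j"
proof -
  have "complex_of_real (icg_eigenvalue n E (j mod int n)) = complex_of_real (icg_eigenvalue n E j)"
    unfolding icg_eigenvalue_zeta[OF assms]
    using assms zeta_mult_mod[of "int n" _ j] by (intro sum.cong) (auto simp: mult.commute)
  then show ?thesis by (simp only: of_real_eq_iff)
qed

lemma icg_eigenvalue_minus: "icg_eigenvalue n E (- j) = icg_eigenvalue n E j"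
proof -
  have "cos (2 * pi * real_of_int (- j * a) / real n) = cos (2 * pi * real_of_int (j * a) / real n)" for a
    using cos_minus[of "2 * pi * real_of_int (j * a) / real n"] by simp
  then show ?thesis by (simp only: icg_eigenvalue_def)
qed

lemma icg_eigenvalue_insert:
  assumes "m \<notin> D"
  shows "icg_eigenvalue n (D \<union> {m}) j = icg_eigenvalue n D j + icg_eigenvalue n {m} j"
  unfolding icg_eigenvalue_def sum.distrib[symmetric]
  using assms by (intro sum.cong) auto

section \<open>Spectral form of the transition matrix\<close>

lemma adjacency_matrix_ICG:
  "adjacency_matrix (ICG n E) =
     mat n n (\<lambda>(a, b). if nat (gcd (int a - int b) (int n)) \<in> E then 1 else 0)"
  by (rule eq_matI) (auto simp: adjacency_matrix_def ICG_def)

text \<open>The eigenvector equation of a circulant matrix: the row vector with entries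
  \<open>zeta n (j * (x - l))\<close> is mapped to a multiple of itself. The substitution
  \<open>c = b - l\<close> moves the dependence on \<open>b\<close> out of the sum.\<close>

lemma adjacency_column_sum:
  assumes "n > 0"
  shows "(\<Sum>l<n. zeta (int n) (j * (x - int l)) *
      (if nat (gcd (int l - b) (int n)) \<in> E then 1 else 0))
    = zeta (int n) (j * (x - b)) * complex_of_real (icg_eigenvalue n E j)"
proof -
  let ?f = "\<lambda>c. if nat (gcd c (int n)) \<in> E then zeta (int n) (j * c) else 0"
  have per: "?f (c mod int n) = ?f c" for c
    using assms zeta_mult_mod[of "int n" j c] by (simp add: gcd_mod_int)
  have "(\<Sum>l<n. zeta (int n) (j * (x - int l)) *
      (if nat (gcd (int l - b) (int n)) \<in> E then 1 else 0))
    = (\<Sum>l<n. zeta (int n) (j * (x - b)) * ?f (b - int l))"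
  proof (intro sum.cong refl)
    fix l
    have "j * (x - int l) = j * (x - b) + j * (b - int l)"
      by (simp add: algebra_simps)
    moreover have "gcd (int l - b) (int n) = gcd (b - int l) (int n)"
      by (metis gcd_neg1_int minus_diff_eq)
    ultimately show "zeta (int n) (j * (x - int l)) *
        (if nat (gcd (int l - b) (int n)) \<in> E then 1 else 0)
      = zeta (int n) (j * (x - b)) * ?f (b - int l)"
      by (simp add: zeta_add)
  qed
  also have "\<dots> = zeta (int n) (j * (x - b)) * (\<Sum>l<n. ?f (b - int l))"
    by (simp add: sum_distrib_left)
  also have "(\<Sum>l<n. ?f (b - int l)) = (\<Sum>c\<in>{0..<int n}. ?f (b - c))"
    by (rule sum.reindex_bij_witness[where i = nat and j = int]) auto
  also have "\<dots> = (\<Sum>c\<in>{0..<int n}. ?f c)"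
    by (rule sum_periodic_reflect) (use assms per in auto)
  finally show ?thesis
    by (simp add: icg_eigenvalue_zeta[OF assms])
qed

lemma pow_mat_Suc_index:
  assumes A: "A \<in> carrier_mat n n" and "a < n" "b < n"
  shows "(A ^\<^sub>m Suc k) $$ (a, b) = (\<Sum>l<n. (A ^\<^sub>m k) $$ (a, l) * A $$ (l, b))"
proof -
  have "A ^\<^sub>m k \<in> carrier_mat n n" using A by simp
  then show ?thesis
    using assms by (simp add: scalar_prod_def lessThan_atLeast0)
qed

text \<open>Spectral decomposition, by induction on \<open>k\<close>: orthogonality of characters
  gives the identity matrix, and each further factor acts through the eigenvector equation. The
  scalar \<open>c\<close> will become \<i> times the time.\<close>

lemma pow_adjacency_matrix_ICG:
  assumes "a < n" "b < n"
  shows "((c \<cdot>\<^sub>m adjacency_matrix (ICG n E)) ^\<^sub>m k) $$ (a, b) =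
    (\<Sum>j\<in>{0..<int n}. (c * complex_of_real (icg_eigenvalue n E j)) ^ k *
       zeta (int n) (j * (int a - int b))) / of_nat n"
  using assms(2)
proof (induction k arbitrary: b)
  case 0
  have "int n dvd int a - int b \<longleftrightarrow> a = b"
    using assms(1) 0 dvd_imp_le_int[of "int a - int b" "int n"]
    by (cases "a < b") (auto simp: abs_if split: if_splits)
  then show ?case
    using assms(1) 0 sum_zeta[of "int n" "int a - int b"]
    by (auto simp: adjacency_matrix_ICG)
next
  case (Suc k)
  have npos: "n > 0" using assms by simp
  let ?A = "c \<cdot>\<^sub>m adjacency_matrix (ICG n E)"
  let ?L = "\<lambda>j. complex_of_real (icg_eigenvalue n E j)"
  let ?chi = "\<lambda>l. if nat (gcd (int l - int b) (int n)) \<in> E then 1 else (0::complex)"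
  have A: "?A \<in> carrier_mat n n" by (simp add: adjacency_matrix_ICG)
  have "(?A ^\<^sub>m Suc k) $$ (a, b) = (\<Sum>l<n. (?A ^\<^sub>m k) $$ (a, l) * ?A $$ (l, b))"
    by (rule pow_mat_Suc_index[OF A assms(1) Suc.prems])
  also have "\<dots> = (\<Sum>l<n. (\<Sum>j\<in>{0..<int n}. (c * ?L j) ^ k *
       zeta (int n) (j * (int a - int l))) / of_nat n * (c * ?chi l))"
    using Suc by (intro sum.cong refl) (simp add: adjacency_matrix_ICG)
  also have "\<dots> = (\<Sum>l<n. \<Sum>j\<in>{0..<int n}. c * (c * ?L j) ^ k *
       (zeta (int n) (j * (int a - int l)) * ?chi l)) / of_nat n"
    unfolding sum_divide_distrib sum_distrib_right
    by (intro sum.cong refl) simp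
  also have "\<dots> = (\<Sum>j\<in>{0..<int n}. c * (c * ?L j) ^ k *
       (\<Sum>l<n. zeta (int n) (j * (int a - int l)) * ?chi l)) / of_nat n"
    by (subst sum.swap) (simp only: sum_distrib_left)
  finally show ?case
    by (simp add: adjacency_column_sum[OF npos] mult_ac)
qed

text \<open>In spectral form the exponential series can be summed separately for each
  eigenvalue.\<close>

lemma transition_matrix_ICG:
  assumes "a < n" "b < n"
  shows "transition_matrix (ICG n E) t $$ (a, b) =
    (\<Sum>j\<in>{0..<int n}. cis (t * icg_eigenvalue n E j) * zeta (int n) (j * (int a - int b))) / of_nat n"
proof -
  let ?A = "(\<i> * complex_of_real t) \<cdot>\<^sub>m adjacency_matrix (ICG n E)"
  let ?L = "\<lambda>j. complex_of_real (icg_eigenvalue n E j)"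
  have "(\<lambda>k. (?A ^\<^sub>m k) $$ (a, b) / fact k) sums
    ((\<Sum>j\<in>{0..<int n}. exp (\<i> * complex_of_real t * ?L j) *
       zeta (int n) (j * (int a - int b))) / of_nat n)"
  proof -
    have "(\<lambda>k. (\<Sum>j\<in>{0..<int n}. ((\<i> * complex_of_real t * ?L j) ^ k /\<^sub>R fact k) *
         zeta (int n) (j * (int a - int b))) / of_nat n) sums
      ((\<Sum>j\<in>{0..<int n}. exp (\<i> * complex_of_real t * ?L j) *
         zeta (int n) (j * (int a - int b))) / of_nat n)"
      by (intro sums_divide sums_sum sums_mult2 exp_converges)
    then show ?thesis
      by (simp add: pow_adjacency_matrix_ICG[OF assms] sum_divide_distrib scaleR_conv_of_real
          field_simps)
  qed
  moreover have "dim_row ?A = n" by (simp add: adjacency_matrix_ICG)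
  ultimately show ?thesis
    using assms
    by (simp add: transition_matrix_def mat_exp_def sums_iff cis_conv_exp mult.assoc)
qed

section \<open>Perfect state transfer as a condition on the spectrum\<close>

text \<open>The equality case of the triangle inequality. With \<open>w\<close> the sum and
  \<open>N\<close> the number of terms, each \<open>Re (cnj w * z y)\<close> is at most
  \<open>N\<close>, and these \<open>N\<close> numbers add up to \<open>N * N\<close>, so each of
  them equals \<open>N\<close>.\<close>

lemma norm_sum_unit_eq_card_iff:
  fixes z :: "'a \<Rightarrow> complex"
  assumes "finite A" "\<And>x. x \<in> A \<Longrightarrow> cmod (z x) = 1"
  shows "cmod (sum z A) = real (card A) \<longleftrightarrow> (\<forall>x\<in>A. \<forall>y\<in>A. z x = z y)"
proof
  assume norm: "cmod (sum z A) = real (card A)"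
  define w where "w = sum z A"
  have "z x = w / of_nat (card A)" if x: "x \<in> A" for x
  proof -
    define N where "N = real (card A)"
    have N: "N > 0" using assms(1) x card_gt_0_iff unfolding N_def by fastforce
    have w: "cmod w = N" using norm by (simp add: w_def N_def)
    have le: "Re (cnj w * z y) \<le> N" if "y \<in> A" for y
      using complex_Re_le_cmod[of "cnj w * z y"] assms(2)[OF that] w by (simp add: norm_mult)
    have "(\<Sum>y\<in>A. N - Re (cnj w * z y)) = N * N - Re (cnj w * w)"
      by (simp add: sum_subtractf w_def sum_distrib_left N_def del: times_complex.sel cnj_sum
          flip: Re_sum)
    also have "\<dots> = 0"
      using w cmod_power2[of w] by (simp add: power2_eq_square)
    finally have "\<forall>y\<in>A. N - Re (cnj w * z y) = 0"
      using le assms(1) by (subst (asm) sum_nonneg_eq_0_iff) auto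
    then have re: "Re (cnj w * z x) = N" using x by simp
    have norm: "cmod (cnj w * z x) = N" using w assms(2)[OF x] by (simp add: norm_mult)
    have "Im v = 0" if "cmod v = N" "Re v = N" for v
      using cmod_power2[of v] that by simp
    from this[OF norm re] have eq: "cnj w * z x = of_real N"
      by (intro complex_eqI) (simp_all only: re Re_complex_of_real Im_complex_of_real)
    \<comment> \<open>Multiplying \<open>cnj w * z x = N\<close> by \<open>w\<close> solves for
      \<open>z x\<close>, with a value independent of \<open>x\<close>.\<close>
    have "of_real (N\<^sup>2) * z x = w * (cnj w * z x)"
      using complex_norm_square[of w] w by (simp add: mult.assoc)
    also have "\<dots> = of_real N * w" by (simp only: eq mult.commute)
    finally show ?thesis using N by (simp add: power2_eq_square field_simps N_def)
  qed
  then show "\<forall>x\<in>A. \<forall>y\<in>A. z x = z y" by simp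
next
  assume eq: "\<forall>x\<in>A. \<forall>y\<in>A. z x = z y"
  show "cmod (sum z A) = real (card A)"
  proof (cases "A = {}")
    case False
    then obtain x where x: "x \<in> A" by auto
    have "sum z A = (\<Sum>y\<in>A. z x)" using eq x by (intro sum.cong refl) blast
    then show ?thesis using assms(2)[OF x] by (simp add: norm_mult)
  qed simp
qed

text \<open>The entry is the mean of \<open>n\<close> numbers of modulus 1, so it has modulus 1 only
  if they all coincide. Periodicity extends this to all integers \<open>j\<close>, including
  negative ones.\<close>

lemma norm_transition_matrix_ICG_eq_1_iff:
  assumes "a < n" "b < n"
  shows "cmod (transition_matrix (ICG n E) t $$ (a, b)) = 1 \<longleftrightarrow>
    (\<forall>j. cis (t * icg_eigenvalue n E j) * zeta (int n) (j * (int a - int b)) =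
       cis (t * icg_eigenvalue n E 0))"
    (is "_ \<longleftrightarrow> (\<forall>j. ?z j = _)")
proof -
  have n: "n > 0" using assms by simp
  have per: "?z (j mod int n) = ?z j" for j
    using n zeta_mult_mod[of "int n" "int a - int b" j] by (simp add: icg_eigenvalue_mod mult.commute)
  have "cmod (transition_matrix (ICG n E) t $$ (a, b)) = 1 \<longleftrightarrow>
      cmod (sum ?z {0..<int n}) = real (card {0..<int n})"
    using n by (simp add: transition_matrix_ICG[OF assms] norm_divide divide_eq_eq)
  also have "\<dots> \<longleftrightarrow> (\<forall>x\<in>{0..<int n}. \<forall>y\<in>{0..<int n}. ?z x = ?z y)"
    by (rule norm_sum_unit_eq_card_iff) (auto simp: norm_mult)
  also have "\<dots> \<longleftrightarrow> (\<forall>j. ?z j = ?z 0)"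
  proof
    assume eq: "\<forall>x\<in>{0..<int n}. \<forall>y\<in>{0..<int n}. ?z x = ?z y"
    have "?z (j mod int n) = ?z 0" for j using n by (intro eq[rule_format]) auto
    then show "\<forall>j. ?z j = ?z 0" by (simp add: per)
  qed metis
  finally show ?thesis by simp
qed

lemma cis_diff_eq_minus_1_iff:
  "cis (x - y) = - 1 \<longleftrightarrow> cis x = - cis y"
  by (metis cis_divide cis_neq_zero divide_eq_eq mult_minus1)

lemma zeta_half:
  assumes "m > 0"
  shows "zeta (2 * m) (j * m) = (if even j then 1 else - 1)"
proof -
  have "zeta (2 * m) (j * m) = zeta 2 j"
    using zeta_cancel[of m 2 j] assms by (simp add: mult.commute)
  also have "\<dots> = zeta 2 (j mod 2)" by (simp add: zeta_mod)
  also have "\<dots> = (if even j then 1 else - 1)"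
    by (auto simp: zeta_def even_iff_mod_2_eq_zero odd_iff_mod_2_eq_one)
  finally show ?thesis .
qed

text \<open>
  The spectrum is symmetric under \<open>j \<mapsto> - j\<close>, so state transfer can only take place
  between vertices at distance \<open>n / 2\<close> on the circle.
\<close>

lemma perfect_state_transfer_ICG_iff:
  assumes "n > 0" "even n"
  shows "perfect_state_transfer (ICG n E) \<longleftrightarrow>
    (\<exists>t>0. \<forall>j. cis (t * (icg_eigenvalue n E (j + 1) - icg_eigenvalue n E j)) = - 1)"
    (is "_ \<longleftrightarrow> (\<exists>t>0. \<forall>j. ?P t j)")
proof -
  define m where "m = int n div 2"
  have m: "int n = 2 * m" "m > 0" using assms by (auto simp: m_def)
  let ?L = "icg_eigenvalue n E"
  \<comment> \<open>Phase steps of - 1 amount to phases alternating in sign, by induction from 0 in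
    both directions.\<close>
  have alternate: "(\<forall>j. ?P t j) \<longleftrightarrow>
      (\<forall>j. cis (t * ?L j) * (if even j then 1 else - 1) = cis (t * ?L 0))" for t
  proof
    assume P: "\<forall>j. ?P t j"
    have step: "cis (t * ?L (j + 1)) = - cis (t * ?L j)" for j
      using P[rule_format, of j] by (simp only: right_diff_distrib cis_diff_eq_minus_1_iff)
    show "\<forall>j. cis (t * ?L j) * (if even j then 1 else - 1) = cis (t * ?L 0)"
    proof
      fix j :: int
      show "cis (t * ?L j) * (if even j then 1 else - 1) = cis (t * ?L 0)"
      proof (induction j rule: int_induct[where k = 0])
        case (step1 i)
        then show ?case using step[of i] by (auto split: if_splits)
      next
        case (step2 i)
        then show ?case using step[of "i - 1"] by (auto split: if_splits)
      qed simp
    qed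
  next
    assume Q: "\<forall>j. cis (t * ?L j) * (if even j then 1 else - 1) = cis (t * ?L 0)"
    show "\<forall>j. ?P t j"
    proof
      fix j
      have "cis (t * ?L (j + 1)) = - cis (t * ?L j)"
        using Q[rule_format, of j] Q[rule_format, of "j + 1"]
        by (cases "even j") (simp, metis minus_minus, simp)
      then show "?P t j" by (simp add: right_diff_distrib cis_diff_eq_minus_1_iff)
    qed
  qed
  show ?thesis
  proof
    assume "perfect_state_transfer (ICG n E)"
    then obtain a b t where ab: "a < n" "b < n" "a \<noteq> b" and t: "t > 0"
      and "cmod (transition_matrix (ICG n E) t $$ (a, b)) = 1"
      by (auto simp: perfect_state_transfer_def ICG_def)
    then have z: "cis (t * ?L j) * zeta (int n) (j * (int a - int b)) = cis (t * ?L 0)" for j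
      by (simp add: norm_transition_matrix_ICG_eq_1_iff)
    let ?x = "int a - int b"
    \<comment> \<open>The eigenvalues at 1 and - 1 agree, so the characters there must agree as
      well; this yields that \<open>n\<close> divides \<open>2 * ?x\<close>.\<close>
    have "zeta (int n) ?x = zeta (int n) (- ?x)"
      using z[of 1] z[of "-1"] by (simp add: icg_eigenvalue_minus) (metis cis_neq_zero mult_left_cancel)
    then have "zeta (int n) (?x + ?x) = zeta (int n) (- ?x + ?x)"
      by (simp only: zeta_add)
    then have "int n dvd 2 * ?x" using assms by (simp add: zeta_eq_1_iff)
    then have "2 * m dvd 2 * ?x" by (simp only: m)
    then have "m dvd ?x" by (subst (asm) dvd_mult_cancel_left) simp
    then obtain c where c: "?x = m * c" by auto
    \<comment> \<open>Two distinct vertices differ by less than \<open>n = 2 * m\<close> in absolute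
      value, which leaves only the difference \<open>m\<close> up to sign.\<close>
    have "- 2 < c" "c < 2" "c \<noteq> 0"
    proof -
      have "m * c < m * 2" "m * (- 2) < m * c" using ab m by (simp_all flip: c)
      then show "- 2 < c" "c < 2" using m by (simp_all only: mult_less_cancel_left_pos)
      show "c \<noteq> 0" using c ab by auto
    qed
    then have "c = 1 \<or> c = - 1" by auto
    then have "zeta (int n) (j * ?x) = (if even j then 1 else - 1)" for j
      using zeta_half[OF m(2), of j] zeta_half[OF m(2), of "- j"] by (auto simp: c m)
    then have "\<forall>j. cis (t * ?L j) * (if even j then 1 else - 1) = cis (t * ?L 0)"
      using z by (simp only: simp_thms)
    then show "\<exists>t>0. \<forall>j. ?P t j" using t unfolding alternate by blast
  next
    assume "\<exists>t>0. \<forall>j. ?P t j"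
    then obtain t where t: "t > 0" and "\<forall>j. ?P t j" by auto
    then have "\<forall>j. cis (t * ?L j) * (if even j then 1 else - 1) = cis (t * ?L 0)"
      using alternate by simp
    \<comment> \<open>The antipodal pair \<open>n / 2\<close> and 0 serves as witness.\<close>
    moreover have h: "nat m < n" "0 < n" "nat m \<noteq> 0" using m by auto
    ultimately have "cmod (transition_matrix (ICG n E) t $$ (nat m, 0)) = 1"
      using zeta_half[OF m(2)] m
      by (simp add: norm_transition_matrix_ICG_eq_1_iff)
    moreover have "pverts (ICG n E) = {0..<n}" by (simp add: ICG_def)
    ultimately show "perfect_state_transfer (ICG n E)"
      unfolding perfect_state_transfer_def using h t
      by (intro bexI[of _ "nat m"] bexI[of _ 0] conjI exI[of _ t]) auto
  qed
qed

section \<open>Contributions of the divisors n / 2 and n / 4\<close>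

text \<open>Among the residues modulo \<open>2 * m\<close>, only \<open>m\<close> itself has gcd
  \<open>m\<close> with the modulus, so the sum has a single term.\<close>

lemma icg_eigenvalue_half:
  assumes "m > 0"
  shows "icg_eigenvalue (2 * m) {m} j = (if even j then 1 else - 1)"
proof -
  have iff: "nat (gcd a (int (2 * m))) \<in> {m} \<longleftrightarrow> a = int m" if a: "a \<in> {0..<int (2 * m)}" for a
  proof
    assume "nat (gcd a (int (2 * m))) \<in> {m}"
    then have "nat (gcd a (2 * int m)) = m" by simp
    then have g: "gcd a (2 * int m) = int m" by (metis gcd_ge_0_int int_nat_eq)
    then have "int m dvd a" by (metis gcd_dvd1)
    then obtain c where c: "a = int m * c" by auto
    have "int m > 0" using assms by simp
    moreover have "int m * 0 \<le> int m * c" "int m * c < int m * 2"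
      using a by (simp_all add: c mult.commute)
    ultimately have "0 \<le> c" "c < 2"
      by (simp_all only: mult_le_cancel_left_pos mult_less_cancel_left_pos)
    moreover have "c \<noteq> 0" using g c assms by auto
    ultimately show "a = int m" using c by auto
  qed auto
  have pos: "2 * m > 0" using assms by simp
  have "complex_of_real (icg_eigenvalue (2 * m) {m} j) =
      (\<Sum>a\<in>{0..<int (2 * m)}. if a = int m then zeta (int (2 * m)) (j * a) else 0)"
    unfolding icg_eigenvalue_zeta[OF pos] by (intro sum.cong refl) (simp only: iff)
  also have "\<dots> = zeta (2 * int m) (j * int m)" using assms by simp
  also have "\<dots> = complex_of_real (if even j then 1 else - 1)"
    using zeta_half[of "int m" j] assms by simp
  finally show ?thesis by (simp only: of_real_eq_iff)
qed

lemma zeta_4: "zeta 4 j = \<i> ^ nat (j mod 4)"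
proof -
  have "zeta 4 j = zeta 4 (j mod 4)" by (simp add: zeta_mod)
  moreover have "j mod 4 \<in> {0, 1, 2, 3}" by auto
  moreover have "zeta 4 1 = \<i>" by (simp add: zeta_def)
  moreover have "zeta 4 2 = zeta 4 1 * zeta 4 1" "zeta 4 3 = zeta 4 1 * zeta 4 1 * zeta 4 1"
    by (simp_all flip: zeta_add)
  ultimately show ?thesis by (auto simp: eval_nat_numeral)
qed

text \<open>Exactly the residues \<open>m\<close> and \<open>3 * m\<close> have gcd \<open>m\<close>
  with \<open>4 * m\<close>. They contribute \<open>zeta 4 j\<close> and its conjugate, hence twice
  the real part of a power of \<i>.\<close>

lemma icg_eigenvalue_quarter:
  assumes "m > 0"
  shows "icg_eigenvalue (4 * m) {m} j = (if 4 dvd j then 2 else if even j then - 2 else 0)"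
proof -
  have iff: "nat (gcd a (int (4 * m))) \<in> {m} \<longleftrightarrow> a \<in> {int m, 3 * int m}"
    if a: "a \<in> {0..<int (4 * m)}" for a
  proof
    assume "nat (gcd a (int (4 * m))) \<in> {m}"
    then have "nat (gcd a (4 * int m)) = m" by simp
    then have g: "gcd a (4 * int m) = int m" by (metis gcd_ge_0_int int_nat_eq)
    then have "int m dvd a" by (metis gcd_dvd1)
    then obtain c where c: "a = int m * c" by auto
    have "int m > 0" using assms by simp
    moreover have "int m * 0 \<le> int m * c" "int m * c < int m * 4"
      using a by (simp_all add: c mult.commute)
    ultimately have "0 \<le> c" "c < 4"
      by (simp_all only: mult_le_cancel_left_pos mult_less_cancel_left_pos)
    then have "c \<in> {0, 1, 2, 3}" by auto
    moreover have "gcd c 4 = 1"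
      using g assms gcd_mult_distrib_int[of "int m" c 4] by (simp add: c mult.commute)
    ultimately have "c = 1 \<or> c = 3" by auto
    then show "a \<in> {int m, 3 * int m}" using c by auto
  next
    assume "a \<in> {int m, 3 * int m}"
    moreover have "gcd (3 * int m) (4 * int m) = int m"
      using gcd_mult_distrib_int[of "int m" 3 4] gcd_red_int[of 4 3]
      by (simp add: mult.commute gcd.commute)
    ultimately show "nat (gcd a (int (4 * m))) \<in> {m}" by auto
  qed
  have pos: "4 * m > 0" using assms by simp
  have "complex_of_real (icg_eigenvalue (4 * m) {m} j) =
      (\<Sum>a\<in>{0..<int (4 * m)}. if a \<in> {int m, 3 * int m} then zeta (int (4 * m)) (j * a) else 0)"
    unfolding icg_eigenvalue_zeta[OF pos] by (intro sum.cong refl) (simp only: iff)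
  also have "\<dots> = (\<Sum>a\<in>{int m, 3 * int m}. zeta (int (4 * m)) (j * a))"
    using assms by (intro sum.mono_neutral_cong_right) auto
  also have "\<dots> = zeta (int m * 4) (int m * j) + zeta (int m * 4) (int m * (3 * j))"
    using assms by (simp add: mult_ac)
  also have "\<dots> = zeta 4 j + zeta 4 (3 * j)"
    using assms by (simp add: zeta_cancel)
  also have "\<dots> = complex_of_real (if 4 dvd j then 2 else if even j then - 2 else 0)"
  proof -
    have iff: "4 dvd j \<longleftrightarrow> j mod 4 = 0" "even j \<longleftrightarrow> j mod 4 = 0 \<or> j mod 4 = 2"
      by presburger+
    have triple: "3 * j mod 4 = 3 * (j mod 4) mod 4" by (simp add: mod_simps)
    have "j mod 4 = 0 \<or> j mod 4 = 1 \<or> j mod 4 = 2 \<or> j mod 4 = 3" by presburger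
    then show ?thesis
      unfolding zeta_4 iff triple by (elim disjE) (simp_all only:, simp_all add: eval_nat_numeral)
  qed
  finally show ?thesis by (simp only: of_real_eq_iff)
qed

section \<open>Vanishing coset sums of the common part D\<close>

text \<open>After division by \<open>N\<close> both gcds are powers of 2. The excluded values are
  those with exponent \<open>k\<close>, \<open>k - 1\<close> or \<open>k - 2\<close>, so the
  exponent \<open>e\<close> is below \<open>k - 2\<close> and adding \<open>2 ^ (k - 2)\<close> does
  not change the 2-adic valuation.\<close>

lemma gcd_shift_quarter:
  fixes a N :: int
  assumes k: "k \<ge> 2" and N: "N > 0" "N dvd a"
    and g: "gcd a (2 ^ k * N) \<notin> {2 ^ k * N, 2 ^ (k - 1) * N, 2 ^ (k - 2) * N}"
  shows "gcd (a + 2 ^ (k - 2) * N) (2 ^ k * N) = gcd a (2 ^ k * N)"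
proof -
  obtain b where b: "a = b * N" using N by (auto simp: mult.commute)
  have scale: "gcd (x * N) (y * N) = gcd x y * N" for x y :: int
    using gcd_mult_distrib_int[of N x y] N by (simp add: mult.commute)
  have "gcd b (2 ^ k) dvd 2 ^ k" by simp
  then obtain e where e: "e \<le> k" "gcd b (2 ^ k) = 2 ^ e"
    using divides_primepow[of "2::int" "gcd b (2 ^ k)" k] by auto
  have ne: "e \<notin> {k, k - 1, k - 2}" using g by (auto simp: b scale e)
  then have lt: "e < k - 2" using e(1) k by auto
  have "gcd (b + 2 ^ (k - 2)) (2 ^ k) = gcd b (2 ^ k)"
  proof -
    \<comment> \<open>Divisibility by the next power \<open>2 ^ Suc e\<close> is what keeps the gcd
      from growing under the shift.\<close>
    have dvd: "2 ^ Suc e dvd (2::int) ^ (k - 2)" using lt by (intro le_imp_power_dvd) simp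
    have b_dvd: "2 ^ e dvd b" by (metis e(2) gcd_dvd1)
    have b_ndvd: "\<not> 2 ^ Suc e dvd b"
    proof
      assume "2 ^ Suc e dvd b"
      moreover have "(2::int) ^ Suc e dvd 2 ^ k" using lt by (intro le_imp_power_dvd) simp
      ultimately have "2 ^ Suc e dvd gcd b (2 ^ k)" by simp
      then show False using e(2) by simp
    qed
    have "gcd (b + 2 ^ (k - 2)) (2 ^ k) dvd 2 ^ k" by simp
    then obtain f where f: "f \<le> k" "gcd (b + 2 ^ (k - 2)) (2 ^ k) = 2 ^ f"
      using divides_primepow[of "2::int" "gcd (b + 2 ^ (k - 2)) (2 ^ k)" k] by auto
    have "2 ^ e dvd b + 2 ^ (k - 2)"
      using b_dvd dvd by (meson dvd_add dvd_trans le_imp_power_dvd lessI less_imp_le)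
    moreover have "(2::int) ^ e dvd 2 ^ k" using e(1) by (rule le_imp_power_dvd)
    ultimately have "(2::int) ^ e dvd 2 ^ f" by (metis f(2) gcd_greatest)
    then have "e \<le> f" by (simp add: dvd_power_iff)
    moreover have "\<not> Suc e \<le> f"
    proof
      assume "Suc e \<le> f"
      then have "2 ^ Suc e dvd (2::int) ^ f" by (rule le_imp_power_dvd)
      also have "2 ^ f dvd b + 2 ^ (k - 2)" by (metis f(2) gcd_dvd1)
      finally have "2 ^ Suc e dvd b" using dvd dvd_add_left_iff by blast
      then show False using b_ndvd by simp
    qed
    ultimately show ?thesis using e f by (simp add: le_antisym not_less_eq_eq)
  qed
  moreover have "a + 2 ^ (k - 2) * N = (b + 2 ^ (k - 2)) * N" by (simp add: b distrib_right)
  ultimately show ?thesis by (simp only: b scale)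
qed

text \<open>
  Summing over a coset of \<open>2 ^ k\<close> retains only those \<open>a\<close> that are multiples of \<open>N\<close>. When \<open>n\<close>, \<open>n / 2\<close>
  and \<open>n / 4\<close> are excluded as values of \<open>gcd a n\<close>, these \<open>a\<close> are permuted by the shift by \<open>n / 4\<close>,
  which multiplies the sum by \<open>zeta 4 u \<noteq> 1\<close>.
\<close>

lemma sum_icg_eigenvalue_coset:
  fixes n k N :: nat and u :: int
  assumes n: "n = 2 ^ k * N" and k: "k \<ge> 2" and N: "N > 0"
    and D: "n \<notin> D" "n div 2 \<notin> D" "n div 4 \<notin> D" and u: "\<not> 4 dvd u"
  shows "(\<Sum>i\<in>{0..<int N}. icg_eigenvalue n D (u + 2 ^ k * i)) = 0"
proof -
  obtain l where l: "k = l + 2" using k by (metis add.commute le_Suc_ex)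
  have npos: "n > 0" using n N by simp
  let ?S = "\<lambda>a. nat (gcd a (int n)) \<in> D"
  let ?g = "\<lambda>a. if ?S a \<and> int N dvd a then zeta (int n) (u * a) else 0"
  have inner: "(\<Sum>i\<in>{0..<int N}. zeta (int n) ((u + 2 ^ k * i) * a))
      = zeta (int n) (u * a) * (if int N dvd a then of_nat N else 0)" for a
  proof -
    have "zeta (int n) ((u + 2 ^ k * i) * a) = zeta (int n) (u * a) * zeta (int N) (i * a)" for i
      using zeta_cancel[of "2 ^ k" "int N" "i * a"]
      by (simp add: distrib_right zeta_add n mult.assoc)
    then show ?thesis
      using N sum_zeta[of "int N" a] by (simp flip: sum_distrib_left)
  qed
  have shift: "?g (a + 2 ^ l * int N) = zeta 4 u * ?g a" for a
  proof (cases "int N dvd a")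
    case dvd: True
    have n': "int n = 2 ^ k * int N" by (simp add: n)
    have z: "zeta (int n) (u * (a + 2 ^ l * int N)) = zeta 4 u * zeta (int n) (u * a)"
    proof -
      have "u * (a + 2 ^ l * int N) = (2 ^ l * int N) * u + u * a" by (simp add: algebra_simps)
      moreover have "int n = (2 ^ l * int N) * 4" by (simp add: n l power_add)
      moreover have "zeta ((2 ^ l * int N) * 4) ((2 ^ l * int N) * u) = zeta 4 u"
        using N by (intro zeta_cancel) simp
      ultimately show ?thesis by (simp only: zeta_add)
    qed
    have quart: "int n = 4 * (2 ^ l * int N)" by (simp add: n l power_add)
    have "?S (a + 2 ^ l * int N) \<longleftrightarrow> ?S a"
    proof (cases "gcd a (2 ^ k * int N) \<in> {2 ^ k * int N, 2 ^ (k - 1) * int N, 2 ^ (k - 2) * int N}")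
      case False
      have "gcd (a + 2 ^ l * int N) (int n) = gcd a (int n)"
        using gcd_shift_quarter[OF k _ dvd False] N by (simp add: n l)
      then show ?thesis by simp
    next
      case True
      let ?q = "2 ^ l * int N"
      have "?q dvd 2 ^ k * int N" "?q dvd 2 ^ (k - 1) * int N" "?q dvd 2 ^ (k - 2) * int N"
        by (simp_all add: l power_add)
      then have "?q dvd gcd a (2 ^ k * int N)"
        using True by fastforce
      then have "?q dvd a" using dvd_trans gcd_dvd1 by blast
      then have "?q dvd a + ?q" "?q dvd a" by auto
      \<comment> \<open>A multiple of \<open>n / 4\<close> has gcd \<open>n / 4\<close>,
        \<open>n / 2\<close> or \<open>n\<close> with \<open>n\<close>, none of which lies in
        \<open>D\<close>. Membership therefore fails both at \<open>a\<close> and at the shifted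
        point.\<close>
      have excl: "\<not> ?S x" if "?q dvd x" for x
      proof -
        obtain c where c: "x = ?q * c" using \<open>?q dvd x\<close> by auto
        have qpos: "?q > 0" using N by simp
        have gx: "gcd x (int n) = ?q * gcd c 4"
          using gcd_mult_distrib_int[of ?q c 4] qpos by (simp add: c quart mult_ac abs_mult)
        have "gcd c 4 dvd 4" "gcd c 4 > 0" by simp_all
        moreover from this have "gcd c 4 \<le> 4" by (intro zdvd_imp_le) simp_all
        moreover have "gcd c 4 \<noteq> 3"
        proof
          assume "gcd c 4 = 3"
          then have "3 dvd (4::int)" by (metis gcd_dvd2)
          then show False by simp
        qed
        ultimately have "gcd c 4 = 1 \<or> gcd c 4 = 2 \<or> gcd c 4 = 4" by linarith
        then have "nat (gcd x (int n)) \<in> {2 ^ l * N, 2 ^ l * N * 2, 2 ^ l * N * 4}"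
          by (auto simp: gx nat_mult_distrib nat_power_eq)
        moreover have "n div 4 = 2 ^ l * N" "n div 2 = 2 ^ l * N * 2" "n = 2 ^ l * N * 4"
          by (simp_all add: n l power_add)
        ultimately show ?thesis using D by (auto simp: mult_ac)
      qed
      then show ?thesis using \<open>?q dvd a + ?q\<close> \<open>?q dvd a\<close> by blast
    qed
    then show ?thesis using z dvd by auto
  next
    case False
    moreover have "\<not> int N dvd a + 2 ^ l * int N" using False by (simp add: dvd_add_left_iff)
    ultimately show ?thesis by auto
  qed
  have Nn: "int N dvd int n" by (simp add: n)
  have per: "?g (a mod int n) = ?g a" for a
    using npos zeta_mult_mod[of "int n" u a] Nn by (simp add: gcd_mod_int dvd_mod_iff)
  have "(\<Sum>a\<in>{0..<int n}. ?g a) = (\<Sum>a\<in>{0..<int n}. ?g (a + 2 ^ l * int N))"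
    by (rule sum_periodic_shift[symmetric]) (use npos per in auto)
  also have "\<dots> = zeta 4 u * (\<Sum>a\<in>{0..<int n}. ?g a)"
    by (simp only: shift sum_distrib_left)
  finally have zero: "(\<Sum>a\<in>{0..<int n}. ?g a) = 0"
    using u by (simp add: zeta_eq_1_iff)
  have "complex_of_real (\<Sum>i\<in>{0..<int N}. icg_eigenvalue n D (u + 2 ^ k * i))
      = (\<Sum>a\<in>{0..<int n}. \<Sum>i\<in>{0..<int N}. if ?S a then zeta (int n) ((u + 2 ^ k * i) * a) else 0)"
    by (simp only: of_real_sum icg_eigenvalue_zeta[OF npos]) (rule sum.swap)
  also have "\<dots> = (\<Sum>a\<in>{0..<int n}. of_nat N * ?g a)"
  proof (rule sum.cong[OF refl])
    fix a
    show "(\<Sum>i\<in>{0..<int N}. if ?S a then zeta (int n) ((u + 2 ^ k * i) * a) else 0) = of_nat N * ?g a"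
      using inner[of a] by (cases "?S a") auto
  qed
  also have "\<dots> = of_nat N * (\<Sum>a\<in>{0..<int n}. ?g a)"
    by (simp only: sum_distrib_left)
  finally show ?thesis using zero by (simp only: mult_zero_right of_real_eq_0_iff)
qed

section \<open>Passing a transfer time from one graph to the other\<close>

lemma cis_sum: "finite A \<Longrightarrow> cis (sum f A) = (\<Prod>x\<in>A. cis (f x))"
  by (induction A rule: finite_induct) (auto simp: cis_mult[symmetric])

text \<open>At time \<open>N * t\<close> the steps of \<open>f\<close> still have phase - 1, since
  \<open>N\<close> is odd. The steps of \<open>g\<close> differ from them by multiples of 4, as
  \<open>c\<close> cancels, and \<open>cis (4 * N * t) = 1\<close> makes these invisible. Both
  directions of the theorem are instances, with opposite signs \<open>s\<close>.\<close>

lemma phase_alternation_transfer: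
  fixes f g :: "int \<Rightarrow> real" and N k :: nat
  assumes "odd N" and f: "\<And>j. cis (t * (f (j + 1) - f j)) = - 1"
    and sum: "(\<Sum>i\<in>{0..<int N}. f (2 + 2 ^ k * i) - f (1 + 2 ^ k * i)) = s * 2 * real N"
    and s: "s \<in> {1, - 1}"
    and cong: "\<And>j. \<exists>m::int. g j - f j = c + 4 * of_int m"
  shows "cis (real N * t * (g (j + 1) - g j)) = - 1"
proof -
  have "cis (t * (s * 2 * real N)) = (\<Prod>i\<in>{0..<int N}. cis (t * (f (2 + 2 ^ k * i) - f (1 + 2 ^ k * i))))"
    by (simp only: sum[symmetric] sum_distrib_left cis_sum finite_atLeastLessThan_int)
  also have "\<dots> = (\<Prod>i\<in>{0..<int N}. - 1)"
  proof (intro prod.cong refl)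
    fix i show "cis (t * (f (2 + 2 ^ k * i) - f (1 + 2 ^ k * i))) = - 1"
      using f[of "1 + 2 ^ k * i"] by (simp add: add.commute add.left_commute)
  qed
  also have "\<dots> = - 1" using \<open>odd N\<close> by simp
  \<comment> \<open>Squaring doubles \<open>2 * N\<close> to \<open>4 * N\<close>, matching the
    modulus 4 in \<open>cong\<close>.\<close>
  finally have "cis (t * (s * 2 * real N)) ^ 2 = 1" by simp
  then have "cis (s * (4 * real N * t)) = 1"
    by (simp add: DeMoivre mult_ac)
  then have one: "cis (4 * real N * t) = 1"
    using s by (auto simp: complex_eq_iff)
  obtain p q :: int where "g (j + 1) - f (j + 1) = c + 4 * of_int p" "g j - f j = c + 4 * of_int q"
    using cong by blast
  then have gf: "g (j + 1) - g j = (f (j + 1) - f j) + 4 * of_int (p - q)" by simp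
  have "cis (real N * t * (g (j + 1) - g j)) =
      cis (real N * (t * (f (j + 1) - f j))) * cis (of_int (p - q) * (4 * real N * t))"
    unfolding gf cis_mult by (simp add: algebra_simps)
  also have "cis (real N * (t * (f (j + 1) - f j))) = - 1"
    using f[of j] \<open>odd N\<close> by (simp flip: DeMoivre)
  also have "cis (of_int (p - q) * (4 * real N * t)) = 1"
    using cis_power_int[of "4 * real N * t" "p - q"] one by (simp only: power_int_1_left)
  finally show ?thesis by simp
qed

theorem mainTheorem5:
  fixes n :: nat and D :: "nat set"
  assumes "n \<ge> 4" and "4 dvd n"
    and "D \<subseteq> {d. d dvd n \<and> 1 \<le> d \<and> d < n}"
    and "n div 2 \<notin> D" and "n div 4 \<notin> D"
  shows "perfect_state_transfer (ICG n (D \<union> {n div 4})) \<longleftrightarrow>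
         perfect_state_transfer (ICG n (D \<union> {n div 2}))"
proof -
  let ?f = "icg_eigenvalue n (D \<union> {n div 4})"
  let ?g = "icg_eigenvalue n (D \<union> {n div 2})"
  have npos: "n > 0" and even: "even n" using assms(1,2) by auto
  obtain k N where n: "n = 2 ^ k * N" and odd: "odd N"
    by (rule multiplicity_decompose'[of n 2]) (use npos in auto)
  have k: "k \<ge> 2"
  proof (rule ccontr)
    assume "\<not> k \<ge> 2"
    then have "k = 0 \<or> k = 1" by auto
    then show False using assms(2) odd by (auto simp: n)
  qed
  have N: "N > 0" using odd by (cases N) auto
  have half: "icg_eigenvalue n {n div 2} j = (if even j then 1 else - 1)" for j
    using icg_eigenvalue_half[of "n div 2" j] assms(1) even by simp
  have quarter: "icg_eigenvalue n {n div 4} j = (if 4 dvd j then 2 else if even j then - 2 else 0)" for j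
    using icg_eigenvalue_quarter[of "n div 4" j] assms(1,2) by simp
  have f: "?f j = icg_eigenvalue n D j + (if 4 dvd j then 2 else if even j then - 2 else 0)" for j
    by (simp only: icg_eigenvalue_insert[OF assms(5)] quarter)
  have g: "?g j = icg_eigenvalue n D j + (if even j then 1 else - 1)" for j
    by (simp only: icg_eigenvalue_insert[OF assms(4)] half)
  have coset: "(\<Sum>i\<in>{0..<int N}. icg_eigenvalue n D (u + 2 ^ k * i)) = 0" if "\<not> 4 dvd u" for u
    using sum_icg_eigenvalue_coset[OF n k N _ assms(4,5) that] assms(3) by auto
  \<comment> \<open>Since 4 divides \<open>2 ^ k\<close>, all members of a coset have the same
    residue modulo 4. Neither 1 nor 2 is a multiple of 4, so the sums of the \<open>D\<close> part
    vanish on both cosets.\<close>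
  have parity: "even (2 + 2 ^ k * i)" "\<not> 4 dvd 2 + 2 ^ k * i" "odd (1 + 2 ^ k * i)"
    "\<not> 4 dvd 1 + 2 ^ k * i" for i :: int
  proof -
    obtain l where "k = l + 2" using k by (metis add.commute le_Suc_ex)
    then have "(2::int) ^ k * i = 4 * (2 ^ l * i)" by (simp add: power_add)
    then show "even (2 + 2 ^ k * i)" "\<not> 4 dvd 2 + 2 ^ k * i" "odd (1 + 2 ^ k * i)"
      "\<not> 4 dvd 1 + 2 ^ k * i" by presburger+
  qed
  \<comment> \<open>Each \<open>i\<close> contributes \<open>- 2 - 0\<close> from
    \<open>n / 4\<close> here, and \<open>1 - (- 1)\<close> from \<open>n / 2\<close> in the next
    sum.\<close>
  have sum_f: "(\<Sum>i\<in>{0..<int N}. ?f (2 + 2 ^ k * i) - ?f (1 + 2 ^ k * i)) = - 1 * 2 * real N"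
    by (simp only: f parity if_True if_False) (simp add: sum_subtractf sum.distrib coset)
  have sum_g: "(\<Sum>i\<in>{0..<int N}. ?g (2 + 2 ^ k * i) - ?g (1 + 2 ^ k * i)) = 1 * 2 * real N"
    by (simp only: g parity if_True if_False) (simp add: sum_subtractf sum.distrib coset)
  \<comment> \<open>For \<open>j\<close> congruent to 0, 1, 2, 3 modulo 4 the difference is
    \<open>- 1\<close>, \<open>- 1\<close>, \<open>3\<close>, \<open>- 1\<close>; only the class of
    2 needs a nonzero multiple of 4.\<close>
  have gf: "\<exists>m::int. ?g j - ?f j = - 1 + 4 * of_int m" for j
    by (rule exI[of _ "if even j \<and> \<not> 4 dvd j then 1 else 0"]) (unfold f g, auto)
  have fg: "\<exists>m::int. ?f j - ?g j = 1 + 4 * of_int m" for j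
    by (rule exI[of _ "if even j \<and> \<not> 4 dvd j then - 1 else 0"]) (unfold f g, auto)
  show ?thesis
    unfolding perfect_state_transfer_ICG_iff[OF npos even]
  proof
    assume "\<exists>t>0. \<forall>j. cis (t * (?f (j + 1) - ?f j)) = - 1"
    then obtain t where t: "t > 0" "\<And>j. cis (t * (?f (j + 1) - ?f j)) = - 1" by auto
    have "cis (real N * t * (?g (j + 1) - ?g j)) = - 1" for j
      by (rule phase_alternation_transfer[OF odd t(2) sum_f _ gf]) simp
    then show "\<exists>t>0. \<forall>j. cis (t * (?g (j + 1) - ?g j)) = - 1"
      using t N by (intro exI[of _ "real N * t"]) simp
  next
    assume "\<exists>t>0. \<forall>j. cis (t * (?g (j + 1) - ?g j)) = - 1"
    then obtain t where t: "t > 0" "\<And>j. cis (t * (?g (j + 1) - ?g j)) = - 1" by auto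
    have "cis (real N * t * (?f (j + 1) - ?f j)) = - 1" for j
      by (rule phase_alternation_transfer[OF odd t(2) sum_g _ fg]) simp
    then show "\<exists>t>0. \<forall>j. cis (t * (?f (j + 1) - ?f j)) = - 1"
      using t N by (intro exI[of _ "real N * t"]) simp
  qed
qed

end
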